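(* Let $f:(0,\infty)\to\mathbb{R}$ be continuously differentiable with $f(x)>0$ for all $x>0$, $f'(x)>0$ for all $x>x_1$ (for some $x_1\ge 0$), and $f'(x)\to 0$ as $x\to\infty$. Suppose that $$\lim_{x\to\infty}\frac{f(x)}{x/\log x}=+\infty,$$ and that $f'$ is decreasing on $[x_2,\infty)$ for some $x_2>0$. Let $\tau>0$, let $\mu$ be a positive finite Borel measure on $[-\tau,0]$, and put $$M:=\int_{[-\tau,0]}\mu(ds)\in(0,\infty),\qquad C:=\int_{[-\tau,0]}|s|\,\mu(ds)<+\infty.$$ Let $\psi\in C([-\tau,0];(0,\infty))$ and let $x$ be the unique continuous solution of $$x'(t)=\int_{[-\tau,0]}\mu(ds)\,f(x(t+s)),\quad t>0;\qquad x(t)=\psi(t),\quad t\in[-\tau,0].$$ Let $F(x)=\int_1^x \frac{1}{f(u)}\,du$ for $x>0$. Then there is a function $c:[1,\infty)\to\mathbb{R}$, continuously differentiable on $(1,\infty)$, with $\lim_{t\to\infty}c(t)=C$, such that $$x(t)=F^{-1}\left(Mt-c(t)\log F^{-1}(Mt)\right),\qquad t\ge 1.$$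
   Context: The function $F$ is strictly increasing and $F(x)\to\infty$ as $x\to\infty$ (since $f(x)/x\to0$), so $F^{-1}$ is defined on the range of $F$, which contains $[0,\infty)$; part of the assertion is that the argument of the outer $F^{-1}$ lies in the range of $F$ for all $t\ge1$. *)

theory Defs
  imports "HOL-Analysis.Analysis"
begin

(* The interval integral is oriented, so for 0 < x < 1 this is minus the integral over {x..1}. *)
definition recip_integral :: "(real \<Rightarrow> real) \<Rightarrow> real \<Rightarrow> real" where
  "recip_integral f x = (LBINT u=ereal 1..ereal x. 1 / f u)"

(* Inverse of the restriction of recip_integral f to (0,\<infinity>); meaningful only on the
   image of (0,\<infinity>) under recip_integral f. *)
definition recip_integral_inv :: "(real \<Rightarrow> real) \<Rightarrow> real \<Rightarrow> real" where
  "recip_integral_inv f = inv_into {0<..} (recip_integral f)"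

(* A continuous solution on [-\<tau>,\<infinity>) of x'(t) = \<integral> f(x(t+s)) \<mu>(ds), t > 0, with history \<psi>.
   Since f is only meaningful on (0,\<infinity>), a solution takes values there. *)
definition delay_solution ::
  "real \<Rightarrow> real measure \<Rightarrow> (real \<Rightarrow> real) \<Rightarrow> (real \<Rightarrow> real) \<Rightarrow> (real \<Rightarrow> real) \<Rightarrow> bool" where
  "delay_solution \<tau> \<mu> f \<psi> x \<longleftrightarrow>
     continuous_on {-\<tau>..} x \<and>
     (\<forall>t\<ge>-\<tau>. x t > 0) \<and>
     (\<forall>t\<in>{-\<tau>..0}. x t = \<psi> t) \<and>
     (\<forall>t>0. (x has_real_derivative (\<integral>s. f (x (t + s)) \<partial>\<mu>)) (at t))"

end

theory Submission
  imports Defs "HOL-Real_Asymp.Real_Asymp"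
begin

text \<open>
  Put \<open>G t = M t - F (x t)\<close> and \<open>H t = ln (f (x t))\<close>. Then \<open>f (x t) G' t\<close> is the \<open>\<mu>\<close>-integral of
  \<open>f (x t) - f (x (t + s))\<close>, which by the mean value theorem, the monotonicity of \<open>f'\<close> and
  \<open>f (x (t - \<tau>)) \<sim> f (x t)\<close> yields \<open>(1 - \<epsilon>) C H' t \<le> G' t \<le> (1 + \<epsilon>) C H' (t - \<tau>)\<close> for large \<open>t\<close>.
  Hence \<open>G \<sim> C H\<close> (in the sense \<open>G / H \<rightarrow> C\<close>), while the growth hypothesis gives \<open>H \<sim> ln x\<close>.
  Finally \<open>ln (x t) \<sim> ln (F\<inverse> (M t))\<close> because \<open>f u = o(u)\<close>, so that
  \<open>c t = G t / ln (F\<inverse> (M t))\<close> tends to \<open>C\<close>.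
\<close>

section \<open>Differentiability and injectivity of the primitive \<open>F\<close> of 1/f\<close>

locale positive_continuous =
  fixes f :: "real \<Rightarrow> real"
  assumes f_cont: "continuous_on {0<..} f"
    and f_pos: "\<And>u. u > 0 \<Longrightarrow> f u > 0"
begin

abbreviation "F \<equiv> recip_integral f"
abbreviation "Finv \<equiv> recip_integral_inv f"

lemma F_deriv:
  assumes "u > 0"
  shows "(F has_real_derivative 1 / f u) (at u)"
proof -
  \<comment> \<open>The closed interval must contain the base point 1 for the fundamental theorem,
    and have \<open>u\<close> in its interior so that the one-interval derivative is a full
    derivative.\<close>
  define a b where "a = min 1 (u / 2)" and "b = max 1 (u + 1)"
  have ab: "a < u" "u < b" "a \<le> 1" "1 \<le> b" "0 < a"
    using assms by (auto simp: a_def b_def)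
  have "continuous_on {a..b} (\<lambda>v. 1 / f v)"
    using ab by (intro continuous_intros continuous_on_subset[OF f_cont]) (auto simp: less_imp_neq[OF f_pos, symmetric])
  from interval_integral_FTC2[OF ab(3,4) this, of u] ab
  have "((\<lambda>v. LBINT y=ereal 1..ereal v. 1 / f y) has_vector_derivative 1 / f u) (at u within {a..b})"
    by (simp add: one_ereal_def)
  moreover have "at u within {a..b} = at u"
    using ab by (intro at_within_interior) auto
  ultimately show ?thesis
    by (simp add: recip_integral_def[abs_def] has_real_derivative_iff_has_vector_derivative)
qed

lemma F_isCont: "u > 0 \<Longrightarrow> isCont F u"
  using F_deriv DERIV_isCont by blast

lemma F_strict_mono:
  assumes "0 < a" "a < b"
  shows "F a < F b"
  using assms(2)
proof (rule DERIV_pos_imp_increasing)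
  fix u assume "a \<le> u" "u \<le> b"
  with assms show "\<exists>y. (F has_real_derivative y) (at u) \<and> 0 < y"
    by (intro exI[of _ "1 / f u"]) (auto intro: F_deriv f_pos)
qed

lemma F_inj: "inj_on F {0<..}"
  by (rule linorder_inj_onI') (use F_strict_mono in force)

lemma F_one [simp]: "F 1 = 0"
  by (simp add: recip_integral_def)

lemma Finv_F: "u > 0 \<Longrightarrow> Finv (F u) = u"
  unfolding recip_integral_inv_def by (simp add: inv_into_f_f[OF F_inj])

end

section \<open>Sublinear \<open>f\<close>: divergence of \<open>F\<close> and its inverse on [0,
  infinity)\<close>

locale sublinear = positive_continuous +
  assumes sublinear: "((\<lambda>u. f u / u) \<longlongrightarrow> 0) at_top"
begin

text \<open>The derivative of \<open>e * F u - ln u\<close> is e/f(u) - 1/u, which is nonnegative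
  once f(u)/u < e. With e = 1 this makes \<open>F\<close> unbounded; with small e it turns bounds on
  differences of \<open>F\<close> into much smaller bounds on differences of logarithms.\<close>

lemma ln_diff_le_F_diff:
  assumes "e > 0"
  obtains N where "N > 0" "\<And>a b. N \<le> a \<Longrightarrow> a \<le> b \<Longrightarrow> ln b - ln a \<le> e * (F b - F a)"
proof -
  have "\<forall>\<^sub>F u in at_top. f u / u < e"
    using sublinear assms by (rule order_tendstoD)
  then obtain N0 where N0: "\<And>u. u \<ge> N0 \<Longrightarrow> f u / u < e"
    by (auto simp: eventually_at_top_linorder)
  define N where "N = max 1 N0"
  have "ln b - ln a \<le> e * (F b - F a)" if "N \<le> a" "a \<le> b" for a b
  proof -
    have "e * F a - ln a \<le> e * F b - ln b"
    proof (rule DERIV_nonneg_imp_nondecreasing[OF that(2)])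
      fix u assume "a \<le> u" "u \<le> b"
      then have u: "u > 0" "u \<ge> N0" using that by (auto simp: N_def)
      have "((\<lambda>u. e * F u - ln u) has_real_derivative e * (1 / f u) - 1 / u) (at u)"
        using u by (auto intro!: derivative_eq_intros F_deriv)
      moreover have "e * (1 / f u) - 1 / u \<ge> 0"
        using N0[OF u(2)] u f_pos[OF u(1)] by (simp add: field_simps)
      ultimately show "\<exists>y. ((\<lambda>u. e * F u - ln u) has_real_derivative y) (at u) \<and> 0 \<le> y"
        by blast
    qed
    then show ?thesis by (simp add: algebra_simps)
  qed
  then show thesis by (intro that[of N]) (auto simp: N_def)
qed

lemma F_at_top: "filterlim F at_top at_top"
proof -
  obtain N where N: "N > 0" "\<And>a b. N \<le> a \<Longrightarrow> a \<le> b \<Longrightarrow> ln b - ln a \<le> 1 * (F b - F a)"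
    using ln_diff_le_F_diff[of 1] by auto
  have "filterlim (\<lambda>u. (F N - ln N) + ln u) at_top at_top"
    by (rule filterlim_tendsto_add_at_top[OF tendsto_const ln_at_top])
  moreover have "\<forall>\<^sub>F u in at_top. (F N - ln N) + ln u \<le> F u"
    using eventually_ge_at_top[of N] by eventually_elim (use N(2)[of N] in force)
  ultimately show ?thesis by (rule filterlim_at_top_mono)
qed

text \<open>Intermediate values between \<open>F 1 = 0\<close> and arbitrarily large values.
  Negative \<open>t\<close> are excluded because \<open>F\<close> stays bounded below near 0
  whenever 1/f is integrable there.\<close>

lemma F_surj:
  assumes "t \<ge> 0"
  obtains u where "u \<ge> 1" "F u = t"
proof -
  have "\<forall>\<^sub>F u in at_top. F u \<ge> t"
    using F_at_top by (auto simp: filterlim_at_top)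
  then obtain b where b: "b \<ge> 1" "F b \<ge> t"
    by (metis eventually_at_top_linorder linorder_le_cases)
  have "\<exists>u\<ge>1. u \<le> b \<and> F u = t"
    using assms b by (intro IVT) (auto intro: F_isCont)
  then show thesis using that by auto
qed

lemma Finv_ge_1: "t \<ge> 0 \<Longrightarrow> Finv t \<ge> 1"
  using F_surj[of t] Finv_F by force

lemma F_Finv: "t \<ge> 0 \<Longrightarrow> F (Finv t) = t"
  using F_surj[of t] Finv_F by force

lemma Finv_gt_1: "t > 0 \<Longrightarrow> Finv t > 1"
  using Finv_ge_1[of t] F_Finv[of t] F_one by (metis less_eq_real_def less_irrefl)

lemma Finv_deriv:
  assumes "t > 0"
  shows "(Finv has_real_derivative f (Finv t)) (at t)"
proof -
  define u where "u = Finv t"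
  have u: "u > 1" "F u = t" using assms Finv_gt_1[of t] F_Finv[of t] by (auto simp: u_def)
  \<comment> \<open>The radius \<open>u - 1\<close> keeps the neighbourhood of \<open>u\<close>
    inside [1, infinity), where \<open>F\<close> is continuous and inverted by
    \<open>Finv\<close>.\<close>
  have "isCont Finv (F u)"
    by (rule isCont_inverse_function[where d = "u - 1"])
      (use u in \<open>auto intro!: Finv_F F_isCont simp: abs_le_iff\<close>)
  then have "(Finv has_real_derivative inverse (1 / f u)) (at t)"
    using u assms f_pos[of u] F_deriv[of u]
    by - (rule DERIV_inverse_function[of F _ _ _ 0 "t + 1"], auto simp: u_def F_Finv)
  then show ?thesis by (simp add: u_def)
qed

lemma Finv_at_top: "filterlim Finv at_top at_top"
  unfolding filterlim_at_top_gt[where c = 1]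
proof safe
  fix Z :: real assume Z: "Z > 1"
  show "\<forall>\<^sub>F t in at_top. Finv t \<ge> Z"
    using eventually_ge_at_top[of "max 0 (F Z)"]
  proof eventually_elim
    case (elim t)
    then have "Finv t \<ge> 1" "F (Finv t) \<ge> F Z" by (auto simp: Finv_ge_1 F_Finv)
    then show ?case using F_strict_mono[of "Finv t" Z] by linarith
  qed
qed

end

section \<open>Limits of quotients with a divergent denominator\<close>

text \<open>Dividing by \<open>H\<close> makes the additive constant vanish in the limit. This suits
  bounds obtained by integrating derivative inequalities, where \<open>K\<close> is the constant of
  integration.\<close>

lemma quotient_tendstoI:
  fixes G H :: "'a \<Rightarrow> real"
  assumes H: "filterlim H at_top A"
    and lower: "\<And>e. e > 0 \<Longrightarrow> \<exists>K. \<forall>\<^sub>F t in A. (C - e) * H t + K \<le> G t"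
    and upper: "\<And>e. e > 0 \<Longrightarrow> \<exists>K. \<forall>\<^sub>F t in A. G t \<le> (C + e) * H t + K"
  shows "((\<lambda>t. G t / H t) \<longlongrightarrow> C) A"
proof -
  have H0: "\<forall>\<^sub>F t in A. H t > 0"
    using H by (auto simp: filterlim_at_top_dense)
  have *: "((\<lambda>t. a + K / H t) \<longlongrightarrow> a) A" for a K
    by (rule tendsto_eq_intros tendsto_divide_0[OF tendsto_const filterlim_at_top_imp_at_infinity] H refl)+ simp
  show ?thesis
  proof (rule order_tendstoI)
    fix a assume "a < C"
    \<comment> \<open>Half of the gap between \<open>a\<close> and \<open>C\<close> is spent on the
      slope; the other half absorbs \<open>K / H t\<close>.\<close>
    then obtain K where K: "\<forall>\<^sub>F t in A. (C - (C - a) / 2) * H t + K \<le> G t"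
      using lower[of "(C - a) / 2"] by auto
    have "\<forall>\<^sub>F t in A. a < (C - (C - a) / 2) + K / H t"
      by (rule order_tendstoD(1)[OF *]) (use \<open>a < C\<close> in \<open>simp add: field_simps\<close>)
    with K H0 show "\<forall>\<^sub>F t in A. a < G t / H t"
    proof eventually_elim
      case (elim t)
      have "(C - (C - a) / 2) + K / H t = ((C - (C - a) / 2) * H t + K) / H t"
        using elim by (simp add: add_divide_distrib)
      also have "\<dots> \<le> G t / H t" using elim by (intro divide_right_mono) auto
      finally show ?case using elim by linarith
    qed
  next
    fix a assume "a > C"
    then obtain K where K: "\<forall>\<^sub>F t in A. G t \<le> (C + (a - C) / 2) * H t + K"
      using upper[of "(a - C) / 2"] by auto
    have "\<forall>\<^sub>F t in A. (C + (a - C) / 2) + K / H t < a"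
      by (rule order_tendstoD(2)[OF *]) (use \<open>a > C\<close> in \<open>simp add: field_simps\<close>)
    with K H0 show "\<forall>\<^sub>F t in A. G t / H t < a"
    proof eventually_elim
      case (elim t)
      have "G t / H t \<le> ((C + (a - C) / 2) * H t + K) / H t"
        using elim by (intro divide_right_mono) auto
      also have "\<dots> = (C + (a - C) / 2) + K / H t"
        using elim by (simp add: add_divide_distrib)
      finally show ?case using elim by linarith
    qed
  qed
qed

lemma filterlim_shift_left_at_top:
  fixes g :: "real \<Rightarrow> 'b"
  assumes "filterlim g A at_top"
  shows "filterlim (\<lambda>t. g (t - c)) A at_top"
  by (rule filterlim_compose[OF assms]) real_asymp

section \<open>Standing hypotheses on \<open>f\<close>, the measure and the solution\<close>

text \<open>A single positive threshold \<open>K\<close>, beyond which \<open>f'\<close> is both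
  positive and decreasing, merges the two thresholds of the theorem.\<close>

locale delay_growth =
  fixes f f' x :: "real \<Rightarrow> real" and \<tau> K M C :: real and \<mu> :: "real measure"
  assumes f_deriv: "\<And>u. u > 0 \<Longrightarrow> (f has_real_derivative f' u) (at u)"
    and f_positive: "\<And>u. u > 0 \<Longrightarrow> f u > 0"
    and K_pos: "K > 0"
    and f'_pos: "\<And>u. u \<ge> K \<Longrightarrow> f' u > 0"
    and f'_lim: "(f' \<longlongrightarrow> 0) at_top"
    and f_growth: "filterlim (\<lambda>u. f u / (u / ln u)) at_top at_top"
    and f'_decr: "\<And>u v. K \<le> u \<Longrightarrow> u \<le> v \<Longrightarrow> f' v \<le> f' u"
    and \<tau>: "\<tau> > 0"
    and \<mu>_sets: "sets \<mu> = sets (restrict_space borel {-\<tau>..0})"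
    and \<mu>_finite: "finite_measure \<mu>"
    and M_def: "M = measure \<mu> {-\<tau>..0}" and M_pos: "M > 0"
    and C_def: "C = (\<integral>s. \<bar>s\<bar> \<partial>\<mu>)"
    and x_cont: "continuous_on {-\<tau>..} x"
    and x_pos: "\<And>t. t \<ge> -\<tau> \<Longrightarrow> x t > 0"
    and x_deriv: "\<And>t. t > 0 \<Longrightarrow> (x has_real_derivative (\<integral>s. f (x (t + s)) \<partial>\<mu>)) (at t)"
begin

sublocale finite_measure \<mu> by (fact \<mu>_finite)

section \<open>Sublinearity, monotonicity and logarithmic growth of \<open>f\<close>\<close>

lemma f_continuous: "continuous_on {0<..} f"
  using f_deriv by (meson DERIV_continuous_on greaterThan_iff has_field_derivative_at_within)

sublocale sublinear f
proof
  show "((\<lambda>u. f u / u) \<longlongrightarrow> 0) at_top"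
  proof (rule lhospital_at_top_at_top[where f' = f' and g' = "\<lambda>_. 1"])
    show "\<forall>\<^sub>F u in at_top. (f has_real_derivative f' u) (at u)"
      using eventually_gt_at_top[of 0] by eventually_elim (rule f_deriv)
  qed (use f'_lim in \<open>auto simp: filterlim_ident\<close>)
qed (use f_continuous f_positive in auto)

lemma f_mono:
  assumes "K \<le> u" "u \<le> v"
  shows "f u \<le> f v"
  using assms(2)
proof (rule DERIV_nonneg_imp_nondecreasing)
  fix w assume "u \<le> w" "w \<le> v"
  then show "\<exists>y. (f has_real_derivative y) (at w) \<and> 0 \<le> y"
    using assms f'_pos[of w] f_deriv[of w] K_pos by (intro exI[of _ "f' w"]) auto
qed

text \<open>For large u the growth hypothesis gives u / ln u \<le> f(u), and sublinearity gives f(u)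
  \<le> u. After taking logarithms the two bounds differ only by ln (ln u) = o(ln u).\<close>

lemma ln_f_asymp: "((\<lambda>u. ln (f u) / ln u) \<longlongrightarrow> 1) at_top"
proof (rule tendsto_sandwich)
  have 1: "\<forall>\<^sub>F u in at_top. f u / (u / ln u) \<ge> 1"
    using f_growth by (auto simp: filterlim_at_top)
  have 2: "\<forall>\<^sub>F u in at_top. f u / u < 1"
    using sublinear by (rule order_tendstoD) simp
  show "\<forall>\<^sub>F u in at_top. (ln u - ln (ln u)) / ln u \<le> ln (f u) / ln u"
    using 1 eventually_gt_at_top[of 1]
  proof eventually_elim
    case (elim u)
    then have "u / ln u \<le> f u" by (simp add: field_simps)
    then have "ln (u / ln u) \<le> ln (f u)" using elim f_pos[of u] by (subst ln_le_cancel_iff) auto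
    then show ?case using elim by (intro divide_right_mono) (auto simp: ln_div)
  qed
  show "\<forall>\<^sub>F u in at_top. ln (f u) / ln u \<le> 1"
    using 2 eventually_gt_at_top[of 1]
  proof eventually_elim
    case (elim u)
    then show ?case using f_pos[of u] by (simp add: field_simps)
  qed
  show "((\<lambda>u::real. (ln u - ln (ln u)) / ln u) \<longlongrightarrow> 1) at_top" by real_asymp
qed simp

section \<open>Integrals against \<open>\<mu>\<close> and continuity of the right-hand side\<close>

lemma space_\<mu>: "space \<mu> = {-\<tau>..0}"
  using sets_eq_imp_space_eq[OF \<mu>_sets] by (simp add: space_restrict_space)

lemma M_eq: "measure \<mu> (space \<mu>) = M"
  by (simp add: M_def space_\<mu>)

lemma integrable_continuous:
  fixes g :: "real \<Rightarrow> real"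
  assumes "continuous_on {-\<tau>..0} g"
  shows "integrable \<mu> g"
proof -
  have "g \<in> borel_measurable \<mu>"
    using borel_measurable_continuous_on_restrict[OF assms]
    by (simp add: measurable_cong_sets[OF \<mu>_sets refl])
  moreover have "bounded (g ` {-\<tau>..0})"
    using assms compact_Icc compact_continuous_image compact_imp_bounded by blast
  then obtain B where "\<And>s. s \<in> {-\<tau>..0} \<Longrightarrow> norm (g s) \<le> B"
    by (metis bounded_iff imageI)
  ultimately show ?thesis
    by (intro integrable_const_bound[where B = B]) (auto simp: space_\<mu>)
qed

lemma h_cont: "continuous_on {-\<tau>..} (\<lambda>t. f (x t))"
  by (rule continuous_on_compose2[OF f_continuous x_cont]) (use x_pos in auto)

lemma h_shift_cont: "t \<ge> 0 \<Longrightarrow> continuous_on {-\<tau>..0} (\<lambda>s. f (x (t + s)))"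
  by (rule continuous_on_compose2[OF h_cont]) (auto intro!: continuous_intros)

definition x' :: "real \<Rightarrow> real" where "x' t = (\<integral>s. f (x (t + s)) \<partial>\<mu>)"

lemma x_deriv': "t > 0 \<Longrightarrow> (x has_real_derivative x' t) (at t)"
  using x_deriv by (simp add: x'_def)

text \<open>Dominated convergence along sequences: a convergent sequence of times is bounded by some
  \<open>B\<close>, so all shifted times stay in the compact interval \<open>{-\<tau>..B}\<close>,
  on which \<open>f (x t)\<close> is bounded. This continuity is what later makes the derivative of
  \<open>c\<close> continuous.\<close>

lemma x'_cont: "continuous_on {0<..} x'"
  unfolding continuous_on_sequentially comp_def
proof safe
  fix u :: "nat \<Rightarrow> real" and t :: real
  assume t: "t > 0" and u: "\<forall>n. u n \<in> {0<..}" "u \<longlonglongrightarrow> t"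
  have "Bseq u" using u(2) by (intro convergent_imp_Bseq convergentI)
  then obtain B where B: "\<And>n. \<bar>u n\<bar> \<le> B" by (auto simp: Bseq_def)
  have "bounded ((\<lambda>t. f (x t)) ` {-\<tau>..B})"
    by (intro compact_imp_bounded compact_continuous_image continuous_on_subset[OF h_cont]) auto
  then obtain D where D: "\<And>s. s \<in> {-\<tau>..B} \<Longrightarrow> norm (f (x s)) \<le> D"
    by (metis bounded_iff imageI)
  show "(\<lambda>n. x' (u n)) \<longlonglongrightarrow> x' t"
    unfolding x'_def
  proof (rule integral_dominated_convergence[where w = "\<lambda>_. D"])
    show "AE s in \<mu>. (\<lambda>n. f (x (u n + s))) \<longlonglongrightarrow> f (x (t + s))"
    proof (rule AE_I2)
      fix s assume "s \<in> space \<mu>"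
      then have s: "-\<tau> \<le> s" "s \<le> 0" by (auto simp: space_\<mu>)
      have "u n > 0" for n using u(1) by auto
      then have "u n + s \<ge> -\<tau>" for n using s by (smt (verit))
      then show "(\<lambda>n. f (x (u n + s))) \<longlonglongrightarrow> f (x (t + s))"
        using t s u(2) by (intro continuous_on_tendsto_compose[OF h_cont] tendsto_intros) auto
    qed
    show "AE s in \<mu>. norm (f (x (u n + s))) \<le> D" for n
    proof (rule AE_I2)
      fix s assume "s \<in> space \<mu>"
      moreover have "u n > 0" "u n \<le> B" using u(1) B[of n] by auto
      ultimately show "norm (f (x (u n + s))) \<le> D" by (intro D) (auto simp: space_\<mu>)
    qed
    show "(\<lambda>s. f (x (u n + s))) \<in> borel_measurable \<mu>" for n
    proof -
      have "u n > 0" using u(1) by auto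
      then show ?thesis by (intro borel_measurable_integrable integrable_continuous h_shift_cont) auto
    qed
    show "(\<lambda>s. f (x (t + s))) \<in> borel_measurable \<mu>"
      using t by (intro borel_measurable_integrable integrable_continuous h_shift_cont) auto
  qed auto
qed

lemma x'_ge:
  assumes "t \<ge> 0" "\<And>s. t - \<tau> \<le> s \<Longrightarrow> s \<le> t \<Longrightarrow> m \<le> f (x s)"
  shows "M * m \<le> x' t"
proof -
  have "(\<integral>s. m \<partial>\<mu>) \<le> x' t"
    unfolding x'_def using assms
    by (intro integral_mono integrable_continuous h_shift_cont) (auto simp: space_\<mu>)
  then show ?thesis by (simp add: M_eq)
qed

lemma x'_le:
  assumes "t \<ge> 0" "\<And>s. t - \<tau> \<le> s \<Longrightarrow> s \<le> t \<Longrightarrow> f (x s) \<le> m"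
  shows "x' t \<le> M * m"
proof -
  have "x' t \<le> (\<integral>s. m \<partial>\<mu>)"
    unfolding x'_def using assms
    by (intro integral_mono integrable_continuous h_shift_cont) (auto simp: space_\<mu>)
  then show ?thesis by (simp add: M_eq)
qed

section \<open>Monotonicity and unboundedness of the solution\<close>

lemma x'_nonneg:
  assumes "t \<ge> 0"
  shows "x' t \<ge> 0"
proof -
  have "M * 0 \<le> x' t"
    using assms by (intro x'_ge) (auto intro!: less_imp_le[OF f_pos] x_pos)
  then show ?thesis by simp
qed

lemma x_mono:
  assumes "0 \<le> a" "a \<le> b"
  shows "x a \<le> x b"
proof (rule DERIV_nonneg_imp_increasing_open[OF assms(2)])
  show "continuous_on {a..b} x" using assms \<tau> by (intro continuous_on_subset[OF x_cont]) auto
next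
  fix t assume "a < t" "t < b"
  then show "\<exists>y. (x has_real_derivative y) (at t) \<and> 0 \<le> y"
    using assms by (intro exI[of _ "x' t"]) (auto intro: x_deriv' x'_nonneg)
qed

text \<open>A bounded monotone solution would keep its values in a compact interval
  \<open>{x 0..L}\<close>, where \<open>f\<close> has a positive minimum. Then \<open>x\<close>
  would grow at least linearly and leave the interval.\<close>

lemma x_at_top: "filterlim x at_top at_top"
proof (rule ccontr)
  assume "\<not> ?thesis"
  then obtain L where L: "\<not> (\<forall>\<^sub>F t in at_top. L \<le> x t)" by (auto simp: filterlim_at_top)
  have bound: "x t < L" if "t \<ge> 0" for t
  proof (rule ccontr)
    assume "\<not> x t < L"
    then have "\<forall>s\<ge>t. L \<le> x s" using x_mono[of t] that by force
    with L show False by (auto simp: eventually_at_top_linorder)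
  qed
  have x0: "x 0 > 0" using x_pos[of 0] \<tau> by simp
  have "x 0 < L" using bound by simp
  have "\<exists>v\<in>{x 0..L}. \<forall>w\<in>{x 0..L}. f v \<le> f w"
    using x0 \<open>x 0 < L\<close> by (intro continuous_attains_inf continuous_on_subset[OF f_continuous]) auto
  then obtain v where v: "v \<in> {x 0..L}" "\<And>w. w \<in> {x 0..L} \<Longrightarrow> f v \<le> f w" by blast
  have fv: "f v > 0" using v(1) x0 by (intro f_pos) auto
  \<comment> \<open>From time \<tau> on, the whole window [t - \<tau>, t] lies in the range where
    \<open>x\<close> is known to be at least \<open>x 0\<close>.\<close>
  have rate: "M * f v \<le> x' t" if "t \<ge> \<tau>" for t
    using that \<tau> by (intro x'_ge v(2)) (auto intro: x_mono less_imp_le[OF bound])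
  \<comment> \<open>Growth at rate \<open>M * f v\<close> from \<tau> to \<open>b\<close> adds
    exactly \<open>L\<close> to the positive value \<open>x \<tau>\<close>.\<close>
  define b where "b = \<tau> + L / (M * f v)"
  have b: "\<tau> \<le> b" using fv M_pos x0 \<open>x 0 < L\<close> by (simp add: b_def)
  have "x \<tau> - M * f v * \<tau> \<le> x b - M * f v * b"
  proof (rule DERIV_nonneg_imp_nondecreasing[OF b])
    fix t assume "\<tau> \<le> t" "t \<le> b"
    then show "\<exists>y. ((\<lambda>t. x t - M * f v * t) has_real_derivative y) (at t) \<and> 0 \<le> y"
      using \<tau> rate[of t] by (intro exI[of _ "x' t - M * f v"]) (auto intro!: derivative_eq_intros x_deriv')
  qed
  moreover have "M * f v * b = M * f v * \<tau> + L"
    using fv M_pos by (simp add: b_def field_simps)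
  moreover have "x \<tau> > 0" using x_pos \<tau> by simp
  ultimately have "x b > L" by linarith
  with bound[of b] b \<tau> show False by simp
qed

section \<open>Increments of \<open>f (x t)\<close> over one delay\<close>

text \<open>The margin is two delays: for t \<ge> T the mean value theorem evaluates derivatives at
  times as early as t - \<tau>, and \<open>x'\<close> at such a time looks back by a further
  \<tau>.\<close>

definition T :: real where
  "T = (SOME T. T > 2 * \<tau> \<and> (\<forall>t \<ge> T - 2 * \<tau>. x t \<ge> K))"

lemma T: "T > 2 * \<tau>" and x_ge_K: "t \<ge> T - 2 * \<tau> \<Longrightarrow> x t \<ge> K"
proof -
  have "\<forall>\<^sub>F t in at_top. x t \<ge> K" using x_at_top by (auto simp: filterlim_at_top)
  then obtain N where N: "\<And>t. t \<ge> N \<Longrightarrow> x t \<ge> K" by (auto simp: eventually_at_top_linorder)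
  have "\<exists>T. T > 2 * \<tau> \<and> (\<forall>t \<ge> T - 2 * \<tau>. x t \<ge> K)"
    by (rule exI[of _ "max (3 * \<tau>) (N + 2 * \<tau>)"]) (use \<tau> in \<open>auto intro!: N\<close>)
  from someI_ex[OF this] show "T > 2 * \<tau>" "t \<ge> T - 2 * \<tau> \<Longrightarrow> x t \<ge> K"
    by (auto simp: T_def)
qed

lemma h_pos: "t \<ge> 0 \<Longrightarrow> f (x t) > 0"
  using f_pos x_pos \<tau> by simp

lemma h_mono: "T - 2 * \<tau> \<le> a \<Longrightarrow> a \<le> b \<Longrightarrow> f (x a) \<le> f (x b)"
  using T x_ge_K by (intro f_mono x_mono) auto

lemma f'_x_decr: "T - 2 * \<tau> \<le> a \<Longrightarrow> a \<le> b \<Longrightarrow> f' (x b) \<le> f' (x a)"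
  using T x_ge_K by (intro f'_decr x_mono) auto

lemma f'_x_pos: "T - 2 * \<tau> \<le> a \<Longrightarrow> f' (x a) > 0"
  using x_ge_K f'_pos by auto

lemma x'_upper: "t \<ge> T - \<tau> \<Longrightarrow> x' t \<le> M * f (x t)"
  using T \<tau> by (intro x'_le h_mono) auto

lemma x'_lower: "t \<ge> T - \<tau> \<Longrightarrow> M * f (x (t - \<tau>)) \<le> x' t"
  using T \<tau> by (intro x'_ge h_mono) auto

lemma h_deriv: "t > 0 \<Longrightarrow> ((\<lambda>t. f (x t)) has_real_derivative f' (x t) * x' t) (at t)"
  using x_pos \<tau> by (intro DERIV_chain2[OF f_deriv x_deriv']) auto

text \<open>The mean value theorem gives the increment as
  \<open>\<bar>s\<bar> * (f' (x z) * x' z)\<close> with z in [t - \<tau>, t]. Since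
  \<open>f'\<close> decreases along the increasing solution, \<open>f' (x z)\<close> is trapped
  between its values at the ends; \<open>x' z\<close> is trapped by the least and greatest values of
  \<open>f (x _)\<close> on the window before z.\<close>

lemma h_increment:
  assumes "t \<ge> T" "-\<tau> \<le> s" "s \<le> 0"
  shows "\<bar>s\<bar> * (f' (x t) * (M * f (x (t - 2 * \<tau>)))) \<le> f (x t) - f (x (t + s))"
    and "f (x t) - f (x (t + s)) \<le> \<bar>s\<bar> * (f' (x (t - \<tau>)) * (M * f (x t)))"
proof -
  consider "s = 0" | "s < 0" using assms by linarith
  then have "\<bar>s\<bar> * (f' (x t) * (M * f (x (t - 2 * \<tau>)))) \<le> f (x t) - f (x (t + s)) \<and>
    f (x t) - f (x (t + s)) \<le> \<bar>s\<bar> * (f' (x (t - \<tau>)) * (M * f (x t)))"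
  proof cases
    case 2
    have "\<exists>z>t + s. z < t \<and> f (x t) - f (x (t + s)) = (t - (t + s)) * (f' (x z) * x' z)"
      using 2 assms T \<tau> by (intro MVT2 h_deriv) auto
    then obtain z where z: "t + s < z" "z < t"
      and eq: "f (x t) - f (x (t + s)) = \<bar>s\<bar> * (f' (x z) * x' z)" using 2 by auto
    have zT: "z \<ge> t - \<tau>" "z \<ge> T - \<tau>" using z assms by auto
    have "M * f (x (t - 2 * \<tau>)) \<le> M * f (x (z - \<tau>))"
      using assms zT M_pos by (intro mult_left_mono h_mono) auto
    also have "\<dots> \<le> x' z" using zT by (intro x'_lower)
    finally have l: "M * f (x (t - 2 * \<tau>)) \<le> x' z" .
    have "x' z \<le> M * f (x z)" using zT by (intro x'_upper)
    also have "\<dots> \<le> M * f (x t)" using z zT M_pos \<tau> by (intro mult_left_mono h_mono) auto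
    finally have u: "x' z \<le> M * f (x t)" .
    have f'z: "f' (x t) \<le> f' (x z)" "f' (x z) \<le> f' (x (t - \<tau>))" "f' (x z) > 0"
      using z zT assms \<tau> by (auto intro!: f'_x_decr f'_x_pos)
    have "M * f (x (t - 2 * \<tau>)) \<ge> 0" using h_pos[of "t - 2 * \<tau>"] M_pos assms T by simp
    then show ?thesis unfolding eq using l u f'z
      by (intro conjI mult_left_mono mult_mono) auto
  qed auto
  then show "\<bar>s\<bar> * (f' (x t) * (M * f (x (t - 2 * \<tau>)))) \<le> f (x t) - f (x (t + s))"
    and "f (x t) - f (x (t + s)) \<le> \<bar>s\<bar> * (f' (x (t - \<tau>)) * (M * f (x t)))" by auto
qed

lemma f'_x_lim: "((\<lambda>t. f' (x t)) \<longlongrightarrow> 0) at_top"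
  by (rule filterlim_compose[OF f'_lim x_at_top])

text \<open>The upper increment bound at s = -\<tau>, divided by \<open>f (x t)\<close>, shows that
  the ratio falls short of 1 by at most \<open>\<tau> * f' (x (t - \<tau>)) * M\<close>, which tends
  to 0.\<close>

lemma delay_ratio: "((\<lambda>t. f (x (t - \<tau>)) / f (x t)) \<longlongrightarrow> 1) at_top"
proof (rule tendsto_sandwich)
  have ev: "\<forall>\<^sub>F t in at_top. t \<ge> T" by (rule eventually_ge_at_top)
  show "\<forall>\<^sub>F t in at_top. 1 - \<tau> * f' (x (t - \<tau>)) * M \<le> f (x (t - \<tau>)) / f (x t)"
    using ev
  proof eventually_elim
    case (elim t)
    then show ?case
      using h_increment(2)[of t "-\<tau>"] \<tau> T h_pos[of t] by (simp add: field_simps)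
  qed
  show "\<forall>\<^sub>F t in at_top. f (x (t - \<tau>)) / f (x t) \<le> 1"
    using ev
  proof eventually_elim
    case (elim t)
    then show ?case using h_mono[of "t - \<tau>" t] \<tau> T h_pos[of t] by (simp add: field_simps)
  qed
  show "((\<lambda>t. 1 - \<tau> * f' (x (t - \<tau>)) * M) \<longlongrightarrow> 1) at_top"
    by (rule tendsto_eq_intros filterlim_shift_left_at_top[OF f'_x_lim] refl)+ simp
qed simp

lemma delay_ratio2: "((\<lambda>t. f (x (t - 2 * \<tau>)) / f (x t)) \<longlongrightarrow> 1) at_top"
proof (rule Lim_transform_eventually)
  show "((\<lambda>t. f (x (t - \<tau> - \<tau>)) / f (x (t - \<tau>)) * (f (x (t - \<tau>)) / f (x t))) \<longlongrightarrow> 1) at_top"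
    by (rule tendsto_eq_intros filterlim_shift_left_at_top[OF delay_ratio] delay_ratio refl)+ simp
  show "\<forall>\<^sub>F t in at_top. f (x (t - \<tau> - \<tau>)) / f (x (t - \<tau>)) * (f (x (t - \<tau>)) / f (x t))
      = f (x (t - 2 * \<tau>)) / f (x t)"
    using eventually_ge_at_top[of T]
  proof eventually_elim
    case (elim t)
    have "f (x (t - \<tau>)) > 0" using elim T \<tau> by (intro h_pos) auto
    then show ?case by (simp add: algebra_simps)
  qed
qed

section \<open>Comparison of \<open>G\<close> with \<open>H\<close> through their
  derivatives\<close>

definition G :: "real \<Rightarrow> real" where "G t = M * t - F (x t)"
definition H :: "real \<Rightarrow> real" where "H t = ln (f (x t))"
definition H' :: "real \<Rightarrow> real" where "H' t = f' (x t) * x' t / f (x t)"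
definition G' :: "real \<Rightarrow> real" where "G' t = M - x' t / f (x t)"

lemma G_deriv: "t > 0 \<Longrightarrow> (G has_real_derivative G' t) (at t)"
  unfolding G_def[abs_def] G'_def using x_pos[of t] \<tau>
  by (auto intro!: derivative_eq_intros DERIV_chain2[OF F_deriv x_deriv'])

lemma H_deriv: "t > 0 \<Longrightarrow> (H has_real_derivative H' t) (at t)"
  unfolding H_def[abs_def] H'_def using h_pos[of t]
  by (auto intro!: derivative_eq_intros h_deriv)

lemma H_at_top: "filterlim H at_top at_top"
proof -
  have "filterlim (\<lambda>u. ln (f u) / ln u * ln u) at_top at_top"
    using ln_f_asymp by (rule filterlim_tendsto_pos_mult_at_top) (auto intro: ln_at_top)
  moreover have "\<forall>\<^sub>F u in at_top. ln (f u) / ln u * ln u = ln (f u)"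
    using eventually_gt_at_top[of 1] by eventually_elim auto
  ultimately have "filterlim (\<lambda>u. ln (f u)) at_top at_top"
    by (simp cong: filterlim_cong)
  from filterlim_compose[OF this x_at_top] show ?thesis by (simp add: H_def[abs_def])
qed

lemma C_nonneg: "C \<ge> 0"
  unfolding C_def by simp

text \<open>As \<open>M\<close> is the total mass of \<open>\<mu>\<close>,
  \<open>M * f (x t)\<close> is the integral of a constant and can be moved under the integral
  defining \<open>x' t\<close>.\<close>

lemma G'_integral:
  assumes "t \<ge> 0"
  shows "G' t * f (x t) = (\<integral>s. f (x t) - f (x (t + s)) \<partial>\<mu>)"
proof -
  have "(\<integral>s. f (x t) - f (x (t + s)) \<partial>\<mu>) = M * f (x t) - x' t"
    unfolding x'_def using assms
    by (subst Bochner_Integration.integral_diff) (auto intro!: integrable_continuous h_shift_cont simp: M_eq)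
  then show ?thesis using h_pos[OF assms] by (simp add: G'_def algebra_simps)
qed

text \<open>Integrating the lower increment bound turns \<open>\<bar>s\<bar>\<close> into
  \<open>C\<close>. The remaining \<open>M * f' (x t)\<close> dominates \<open>H' t\<close> because
  \<open>x' t \<le> M * f (x t)\<close>.\<close>

lemma G'_lower:
  assumes "t \<ge> T"
  shows "C * (f (x (t - 2 * \<tau>)) / f (x t)) * H' t \<le> G' t"
proof -
  have t: "t > 0" "f (x t) > 0" "f (x (t - 2 * \<tau>)) > 0" using assms T \<tau> by (auto intro!: h_pos)
  have "C * (f' (x t) * (M * f (x (t - 2 * \<tau>)))) = (\<integral>s. \<bar>s\<bar> * (f' (x t) * (M * f (x (t - 2 * \<tau>)))) \<partial>\<mu>)"
    by (simp add: C_def)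
  also have "\<dots> \<le> (\<integral>s. f (x t) - f (x (t + s)) \<partial>\<mu>)"
    using t assms by (intro integral_mono integrable_continuous h_shift_cont h_increment continuous_intros)
      (auto simp: space_\<mu>)
  also have "\<dots> = G' t * f (x t)" using t by (simp add: G'_integral)
  finally have "C * (f' (x t) * (M * f (x (t - 2 * \<tau>)))) / f (x t) \<le> G' t" using t by (simp add: field_simps)
  moreover have "C * (f (x (t - 2 * \<tau>)) / f (x t)) * H' t
      \<le> C * (f (x (t - 2 * \<tau>)) / f (x t)) * (f' (x t) * (M * f (x t)) / f (x t))"
    unfolding H'_def using assms t C_nonneg T \<tau> f'_x_pos[of t] x'_upper[of t]
    by (intro mult_left_mono divide_right_mono) auto
  ultimately show ?thesis using t by (simp add: field_simps)
qed

text \<open>Integration of the upper increment bound. Here \<open>f'\<close> is evaluated one delay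
  earlier, which is why the integrated upper bound has to be compared with \<open>H\<close> at time
  t - \<tau>.\<close>

lemma G'_upper:
  assumes "t \<ge> T"
  shows "G' t \<le> C * (M * f' (x (t - \<tau>)))"
proof -
  have t: "t > 0" "f (x t) > 0" using assms T \<tau> by (auto intro!: h_pos)
  have "G' t * f (x t) = (\<integral>s. f (x t) - f (x (t + s)) \<partial>\<mu>)" using t by (simp add: G'_integral)
  also have "\<dots> \<le> (\<integral>s. \<bar>s\<bar> * (f' (x (t - \<tau>)) * (M * f (x t))) \<partial>\<mu>)"
    using t assms by (intro integral_mono integrable_continuous h_shift_cont h_increment continuous_intros)
      (auto simp: space_\<mu>)
  also have "\<dots> = C * (f' (x (t - \<tau>)) * (M * f (x t)))" by (simp add: C_def)
  finally show ?thesis using t by (simp add: field_simps)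
qed

lemma G_lower:
  assumes "e > 0"
  shows "\<exists>B. \<forall>\<^sub>F t in at_top. (C - e) * H t + B \<le> G t"
proof -
  \<comment> \<open>The denominator \<open>C + 1\<close> gives C d \<le> e and stays positive if C =
    0, as for a point mass at 0.\<close>
  define d where "d = e / (C + 1)"
  have d: "d > 0" "C * d \<le> e" using assms C_nonneg by (auto simp: d_def field_simps)
  have "\<forall>\<^sub>F t in at_top. f (x (t - 2 * \<tau>)) / f (x t) > 1 - d"
    using delay_ratio2 by (rule order_tendstoD) (use d in auto)
  then obtain N where N: "\<And>t. t \<ge> N \<Longrightarrow> f (x (t - 2 * \<tau>)) / f (x t) > 1 - d"
    by (auto simp: eventually_at_top_linorder)
  define S where "S = max T N"
  have "(C - e) * H t + (G S - (C - e) * H S) \<le> G t" if "t \<ge> S" for t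
  proof -
    have "G S - (C - e) * H S \<le> G t - (C - e) * H t"
    proof (rule DERIV_nonneg_imp_nondecreasing[OF that])
      fix u assume "S \<le> u" "u \<le> t"
      then have u: "u \<ge> T" "u > 0" "u \<ge> N" using T \<tau> by (auto simp: S_def)
      have "H' u \<ge> 0" using u \<tau> f'_x_pos[of u] x'_nonneg[of u] h_pos[of u] by (simp add: H'_def)
      have "C - e \<le> C * (1 - d)" using d by (simp add: algebra_simps)
      also have "\<dots> \<le> C * (f (x (u - 2 * \<tau>)) / f (x u))"
        using N[OF u(3)] C_nonneg by (intro mult_left_mono) auto
      finally have "(C - e) * H' u \<le> C * (f (x (u - 2 * \<tau>)) / f (x u)) * H' u"
        using \<open>H' u \<ge> 0\<close> by (rule mult_right_mono)
      also have "\<dots> \<le> G' u" using u by (intro G'_lower)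
      finally show "\<exists>y. ((\<lambda>t. G t - (C - e) * H t) has_real_derivative y) (at u) \<and> 0 \<le> y"
        using u by (intro exI[of _ "G' u - (C - e) * H' u"])
          (auto intro!: derivative_eq_intros G_deriv H_deriv)
    qed
    then show ?thesis by simp
  qed
  then show ?thesis unfolding eventually_at_top_linorder by blast
qed

lemma H_mono: "T \<le> a \<Longrightarrow> a \<le> b \<Longrightarrow> H a \<le> H b"
  unfolding H_def using T \<tau> h_pos[of a] h_pos[of b] h_mono[of a b] by simp

text \<open>The difference \<open>G t - (C + e) * H (t - \<tau>)\<close> is eventually
  nonincreasing: \<open>x'\<close> at u - \<tau> is at least
  \<open>M * f (x (u - 2 * \<tau>))\<close>, and by \<open>delay_ratio\<close> this is nearly
  \<open>M * f (x (u - \<tau>))\<close>. Hence \<open>M * f' (x (u - \<tau>))\<close> is at most (1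
  + d) times \<open>H' (u - \<tau>)\<close>.\<close>

lemma G_upper:
  assumes "e > 0"
  shows "\<exists>B. \<forall>\<^sub>F t in at_top. G t \<le> (C + e) * H t + B"
proof -
  define d where "d = e / (C + 1)"
  have d: "d > 0" "C * d \<le> e" using assms C_nonneg by (auto simp: d_def field_simps)
  have "\<forall>\<^sub>F t in at_top. f (x (t - \<tau>)) / f (x t) > 1 / (1 + d)"
    using delay_ratio by (rule order_tendstoD) (use d in auto)
  then obtain N where N: "\<And>t. t \<ge> N \<Longrightarrow> f (x (t - \<tau>)) / f (x t) > 1 / (1 + d)"
    by (auto simp: eventually_at_top_linorder)
  \<comment> \<open>Both thresholds are moved by \<tau> because the estimates are applied at u -
    \<tau>.\<close>
  define S where "S = max (T + \<tau>) (N + \<tau>)"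
  have "G t \<le> (C + e) * H t + (G S - (C + e) * H (S - \<tau>))" if "t \<ge> S" for t
  proof -
    have "G S - (C + e) * H (S - \<tau>) \<ge> G t - (C + e) * H (t - \<tau>)"
    proof (rule DERIV_nonpos_imp_nonincreasing[OF that])
      fix u assume "S \<le> u" "u \<le> t"
      then have u: "u - \<tau> \<ge> T" "u > 0" "u - \<tau> > 0" "u - \<tau> \<ge> N" using T \<tau> by (auto simp: S_def)
      have pos: "f (x (u - \<tau>)) > 0" "f' (x (u - \<tau>)) > 0" "H' (u - \<tau>) \<ge> 0"
        using u \<tau> f'_x_pos[of "u - \<tau>"] x'_nonneg[of "u - \<tau>"] h_pos[of "u - \<tau>"] by (auto simp: H'_def)
      have "M * f (x (u - \<tau>)) \<le> M * ((1 + d) * f (x (u - \<tau> - \<tau>)))"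
        using N[OF u(4)] d pos M_pos by (intro mult_left_mono) (auto simp: field_simps)
      also have "\<dots> \<le> (1 + d) * x' (u - \<tau>)"
        using x'_lower[of "u - \<tau>"] u \<tau> d by (simp add: mult.left_commute[of M])
      finally have "M \<le> (1 + d) * (x' (u - \<tau>) / f (x (u - \<tau>)))" using pos by (simp add: field_simps)
      then have "M * f' (x (u - \<tau>)) \<le> (1 + d) * (x' (u - \<tau>) / f (x (u - \<tau>))) * f' (x (u - \<tau>))"
        using pos by (intro mult_right_mono) auto
      also have "\<dots> = (1 + d) * H' (u - \<tau>)" by (simp add: H'_def)
      finally have "C * (M * f' (x (u - \<tau>))) \<le> C * ((1 + d) * H' (u - \<tau>))"
        using C_nonneg by (intro mult_left_mono)
      moreover have "(C * (1 + d)) * H' (u - \<tau>) \<le> (C + e) * H' (u - \<tau>)"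
        using d pos by (intro mult_right_mono) (auto simp: algebra_simps)
      moreover have "G' u \<le> C * (M * f' (x (u - \<tau>)))" using u \<tau> by (intro G'_upper) auto
      ultimately have "G' u \<le> (C + e) * H' (u - \<tau>)" by (simp add: mult.assoc)
      moreover have "((\<lambda>t. H (t - \<tau>)) has_real_derivative H' (u - \<tau>) * 1) (at u)"
        using u by (intro DERIV_chain2[OF H_deriv]) (auto intro!: derivative_eq_intros)
      ultimately show "\<exists>y. ((\<lambda>t. G t - (C + e) * H (t - \<tau>)) has_real_derivative y) (at u) \<and> y \<le> 0"
        using u by (intro exI[of _ "G' u - (C + e) * H' (u - \<tau>)"])
          (auto intro!: derivative_eq_intros G_deriv)
    qed
    \<comment> \<open>Monotonicity of \<open>H\<close> removes the delay from the integrated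
      bound.\<close>
    moreover have "(C + e) * H (t - \<tau>) \<le> (C + e) * H t"
      using that \<tau> C_nonneg assms by (intro mult_left_mono H_mono) (auto simp: S_def)
    ultimately show ?thesis by simp
  qed
  then show ?thesis unfolding eventually_at_top_linorder by blast
qed

text \<open>The quotient factors through \<open>H\<close>: \<open>G t / H t\<close> tends to
  \<open>C\<close> by the two integrated bounds, and \<open>H t / ln (x t)\<close> tends to 1 by
  \<open>ln_f_asymp\<close> along the solution.\<close>

lemma G_asymp_ln_x: "((\<lambda>t. G t / ln (x t)) \<longlongrightarrow> C) at_top"
proof (rule Lim_transform_eventually)
  show "((\<lambda>t. G t / H t * (H t / ln (x t))) \<longlongrightarrow> C) at_top"
  proof -
    have "((\<lambda>t. H t / ln (x t)) \<longlongrightarrow> 1) at_top"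
      unfolding H_def by (rule filterlim_compose[OF ln_f_asymp x_at_top])
    from tendsto_mult[OF quotient_tendstoI[OF H_at_top G_lower G_upper] this] show ?thesis by simp
  qed
  have "\<forall>\<^sub>F t in at_top. H t > 0" using H_at_top by (auto simp: filterlim_at_top_dense)
  then show "\<forall>\<^sub>F t in at_top. G t / H t * (H t / ln (x t)) = G t / ln (x t)"
    by eventually_elim auto
qed

section \<open>Replacing \<open>ln (x t)\<close> by the logarithm of
  \<open>Finv (M * t)\<close>\<close>

text \<open>This is the solution of the undelayed equation y' = M f(y) with y(0) = 1.\<close>

definition y :: "real \<Rightarrow> real" where "y t = Finv (M * t)"

lemma y_at_top: "filterlim y at_top at_top"
  unfolding y_def[abs_def]
  by (rule filterlim_compose[OF Finv_at_top filterlim_tendsto_pos_mult_at_top[OF tendsto_const M_pos filterlim_ident]])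

text \<open>Since \<open>f u = o(u)\<close>, a difference \<open>F b - F a\<close> of size \<open>O(ln a)\<close> forces \<open>ln b - ln a = o(ln a)\<close>.\<close>

lemma ln_y_asymp_ln_x: "((\<lambda>t. ln (y t) / ln (x t)) \<longlongrightarrow> 1) at_top"
proof -
  have lnx: "\<forall>\<^sub>F t in at_top. x t > 1" using x_at_top by (auto simp: filterlim_at_top_dense)
  have "((\<lambda>t. ln (y t) / ln (x t) - 1) \<longlongrightarrow> 0) at_top"
  proof (rule tendstoI)
    fix e :: real assume e: "e > 0"
    \<comment> \<open>Eventually \<bar>G\<bar> < (C + 1) ln x, so the factor \<open>d\<close> brings
      the difference of logarithms below e ln x.\<close>
    define d where "d = e / (C + 1)"
    have d: "d > 0" "d * (C + 1) = e" using e C_nonneg by (auto simp: d_def field_simps)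
    obtain N where N: "N > 0" "\<And>a b. N \<le> a \<Longrightarrow> a \<le> b \<Longrightarrow> ln b - ln a \<le> d * (F b - F a)"
      using ln_diff_le_F_diff[OF d(1)] by blast
    have "\<forall>\<^sub>F t in at_top. x t \<ge> N" "\<forall>\<^sub>F t in at_top. y t \<ge> N"
      using x_at_top y_at_top by (auto simp: filterlim_at_top)
    moreover have "\<forall>\<^sub>F t in at_top. \<bar>G t / ln (x t)\<bar> < C + 1"
      using tendsto_rabs[OF G_asymp_ln_x] by (rule order_tendstoD) (use C_nonneg in auto)
    ultimately show "\<forall>\<^sub>F t in at_top. dist (ln (y t) / ln (x t) - 1) 0 < e"
      using lnx eventually_gt_at_top[of 0]
    proof eventually_elim
      case (elim t)
      have "F (y t) = M * t" using elim M_pos by (simp add: y_def F_Finv)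
      then have G: "G t = F (y t) - F (x t)" by (simp add: G_def)
      \<comment> \<open>The sign of \<open>G t\<close> is not known, so both orders of
        \<open>x t\<close> and \<open>y t\<close> are prepared.\<close>
      have le: "ln (y t) - ln (x t) \<le> d * (F (y t) - F (x t))" if "x t \<le> y t"
        using N(2)[of "x t" "y t"] that elim by auto
      have ge: "ln (x t) - ln (y t) \<le> d * (F (x t) - F (y t))" if "y t \<le> x t"
        using N(2)[of "y t" "x t"] that elim by auto
      have "\<bar>ln (y t) - ln (x t)\<bar> \<le> d * \<bar>G t\<bar>"
      proof (cases "x t \<le> y t")
        case True
        then have "ln (x t) \<le> ln (y t)" using elim by simp
        moreover have "d * G t \<le> d * \<bar>G t\<bar>" using d by (intro mult_left_mono) auto
        ultimately show ?thesis using le[OF True] by (simp add: G)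
      next
        case False
        then have "ln (y t) \<le> ln (x t)" using elim N(1) by simp
        moreover have "d * (- G t) \<le> d * \<bar>G t\<bar>" using d by (intro mult_left_mono) auto
        moreover have "d * (F (x t) - F (y t)) = d * (- G t)" by (simp add: G)
        ultimately show ?thesis using ge False by linarith
      qed
      moreover have "\<bar>G t\<bar> < (C + 1) * ln (x t)" using elim by (simp add: abs_divide field_simps)
      then have "d * \<bar>G t\<bar> < d * ((C + 1) * ln (x t))" using d by (intro mult_strict_left_mono)
      moreover have "d * ((C + 1) * ln (x t)) = e * ln (x t)" using d by (simp add: mult.assoc[symmetric])
      ultimately have "\<bar>ln (y t) - ln (x t)\<bar> < e * ln (x t)" by linarith
      moreover have "\<bar>ln (y t) / ln (x t) - 1\<bar> = \<bar>ln (y t) - ln (x t)\<bar> / ln (x t)"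
        using elim by (simp add: diff_divide_distrib[symmetric] abs_divide divide_simps)
      ultimately show ?case using elim by (simp add: divide_simps)
    qed
  qed
  then show ?thesis by (simp add: LIM_zero_iff)
qed

section \<open>The function \<open>c\<close>: limit, smoothness and defining equation\<close>

text \<open>Obtained by solving \<open>F (x t) = M * t - c t * ln (y t)\<close> for
  \<open>c t\<close>.\<close>

definition c :: "real \<Rightarrow> real" where "c t = G t / ln (y t)"

lemma c_tendsto: "(c \<longlongrightarrow> C) at_top"
proof (rule Lim_transform_eventually)
  show "((\<lambda>t. G t / ln (x t) / (ln (y t) / ln (x t))) \<longlongrightarrow> C) at_top"
    using tendsto_divide[OF G_asymp_ln_x ln_y_asymp_ln_x] by simp
  have "\<forall>\<^sub>F t in at_top. x t > 1" using x_at_top by (auto simp: filterlim_at_top_dense)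
  then show "\<forall>\<^sub>F t in at_top. G t / ln (x t) / (ln (y t) / ln (x t)) = c t"
    by eventually_elim (auto simp: c_def)
qed

text \<open>Makes \<open>ln (y t)\<close> positive for every t > 0, so that division by it is
  legitimate from the start and not only eventually.\<close>

lemma y_gt_1: "t > 0 \<Longrightarrow> y t > 1"
  using Finv_gt_1[of "M * t"] M_pos by (simp add: y_def)

lemma y_deriv: "t > 0 \<Longrightarrow> (y has_real_derivative f (y t) * M) (at t)"
  unfolding y_def[abs_def] using M_pos
  by (intro DERIV_chain2[OF Finv_deriv]) (auto intro!: derivative_eq_intros)

lemma c_C1: "c C1_differentiable_on {0<..}"
  unfolding C1_differentiable_on_def
proof (intro exI conjI ballI)
  \<comment> \<open>The quotient rule applied to \<open>G t / ln (y t)\<close>.\<close>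
  let ?D = "\<lambda>t. (G' t * ln (y t) - G t * (f (y t) * M / y t)) / (ln (y t) * ln (y t))"
  have ln_y: "((\<lambda>t. ln (y t)) has_real_derivative f (y t) * M / y t) (at t)" if "t > 0" for t
    using y_gt_1[OF that] that by (auto intro!: derivative_eq_intros y_deriv)
  have "(c has_real_derivative ?D t) (at t)" if "t > 0" for t
    unfolding c_def[abs_def] using y_gt_1[OF that] that
    by (intro DERIV_divide G_deriv ln_y) auto
  then show "(c has_vector_derivative ?D t) (at t)" if "t \<in> {0<..}" for t
    using that by (simp add: has_real_derivative_iff_has_vector_derivative)
  have cont: "continuous_on {0<..} G" "continuous_on {0<..} y" "continuous_on {0<..} (\<lambda>t. ln (y t))"
    using DERIV_isCont[OF G_deriv] DERIV_isCont[OF y_deriv] DERIV_isCont[OF ln_y]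
    by (auto intro!: continuous_at_imp_continuous_on)
  have "continuous_on {0<..} (\<lambda>t. f (x t))"
    using \<tau> by (intro continuous_on_subset[OF h_cont]) auto
  then have "continuous_on {0<..} G'"
    unfolding G'_def[abs_def] by (intro continuous_intros x'_cont) (auto simp: less_imp_neq[OF h_pos, symmetric])
  moreover have "continuous_on {0<..} (\<lambda>t. f (y t))"
    by (rule continuous_on_compose2[OF f_continuous cont(2)]) (use y_gt_1 in force)
  ultimately show "continuous_on {0<..} ?D"
    by (intro continuous_intros cont) (auto dest: y_gt_1)
qed

lemma c_equation:
  assumes "t > 0"
  shows "M * t - c t * ln (Finv (M * t)) = F (x t)"
proof -
  have "ln (y t) > 0" using y_gt_1[OF assms] by simp
  then show ?thesis by (simp add: c_def G_def y_def)
qed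

end

section \<open>Passage from the stated hypotheses to the asymptotic representation\<close>

theorem theorem2:
  fixes f \<psi> x :: "real \<Rightarrow> real" and \<tau> x1 x2 M C :: real and \<mu> :: "real measure"
  assumes f_C1: "f C1_differentiable_on {0<..}"
    and f_pos: "\<forall>u>0. f u > 0"
    and x1: "x1 \<ge> 0" and f'_pos: "\<forall>u>x1. deriv f u > 0"
    and f'_lim: "(deriv f \<longlongrightarrow> 0) at_top"
    and f_growth: "filterlim (\<lambda>u. f u / (u / ln u)) at_top at_top"
    and x2: "x2 > 0" and f'_decr: "antimono_on {x2..} (deriv f)"
    and \<tau>: "\<tau> > 0"
    and \<mu>_sets: "sets \<mu> = sets (restrict_space borel {-\<tau>..0})"
    and \<mu>_finite: "finite_measure \<mu>"
    and M_def: "M = measure \<mu> {-\<tau>..0}" and M_pos: "M > 0"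
    and C_def: "C = (\<integral>s. \<bar>s\<bar> \<partial>\<mu>)"
    and \<psi>_cont: "continuous_on {-\<tau>..0} \<psi>"
    and \<psi>_pos: "\<forall>t\<in>{-\<tau>..0}. \<psi> t > 0"
    and x_sol: "delay_solution \<tau> \<mu> f \<psi> x"
  shows "\<exists>c :: real \<Rightarrow> real.
           c C1_differentiable_on {1<..} \<and>
           (c \<longlongrightarrow> C) at_top \<and>
           (\<forall>t\<ge>1.
              M * t - c t * ln (recip_integral_inv f (M * t)) \<in> recip_integral f ` {0<..} \<and>
              x t = recip_integral_inv f (M * t - c t * ln (recip_integral_inv f (M * t))))"
proof -
  have deriv: "(f has_real_derivative deriv f u) (at u)" if "u > 0" for u
  proof -
    obtain D where "(f has_real_derivative D) (at u)"
      using f_C1 \<open>u > 0\<close>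
      by (auto simp: C1_differentiable_on_def has_real_derivative_iff_has_vector_derivative)
    then show ?thesis using DERIV_imp_deriv by blast
  qed
  \<comment> \<open>The threshold is positive, strictly above \<open>x1\<close> for the sign of the
    derivative, and above \<open>x2\<close> for its monotonicity.\<close>
  interpret delay_growth f "deriv f" x \<tau> "x1 + x2 + 1" M C \<mu>
  proof (rule delay_growth.intro)
    show "deriv f v \<le> deriv f u" if "x1 + x2 + 1 \<le> u" "u \<le> v" for u v
      using monotone_onD[OF f'_decr, of u v] that x1 by simp
    show "continuous_on {-\<tau>..} x"
      using x_sol by (simp add: delay_solution_def)
    show "x t > 0" if "t \<ge> -\<tau>" for t
      using x_sol that by (simp add: delay_solution_def)
    show "(x has_real_derivative (\<integral>s. f (x (t + s)) \<partial>\<mu>)) (at t)" if "t > 0" for t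
      using x_sol that by (simp add: delay_solution_def)
    show "(f has_real_derivative deriv f u) (at u)" if "u > 0" for u
      using that by (rule deriv)
    show "deriv f u > 0" if "u \<ge> x1 + x2 + 1" for u
      using f'_pos x2 that by simp
  qed (use x1 x2 f_pos f'_lim f_growth \<tau> \<mu>_sets \<mu>_finite M_def M_pos C_def in simp_all)
  show ?thesis
  proof (intro exI[of _ c] conjI allI impI)
    show "c C1_differentiable_on {1<..}"
      by (rule C1_differentiable_on_subset[OF c_C1]) auto
    show "(c \<longlongrightarrow> C) at_top" by (rule c_tendsto)
  next
    fix t :: real assume "t \<ge> 1"
    then have "t > 0" "x t > 0" using x_pos[of t] \<tau> by auto
    \<comment> \<open>By \<open>c_equation\<close> the argument of the outer inverse equals
      \<open>F (x t)\<close> with \<open>x t > 0\<close>; this gives membership in the range and the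
      value of the inverse at once.\<close>
    then show "M * t - c t * ln (Finv (M * t)) \<in> F ` {0<..}"
      and "x t = Finv (M * t - c t * ln (Finv (M * t)))"
      by (auto simp: c_equation Finv_F)
  qed
qed

end
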